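(* Let user affinities be standard normal, $A\sim\mathcal N(0,1)$, let $c\ge0$, $e\ge0$, and for $e>\sqrt{2\pi}$ define $$c_l(e)=e\,Q(q^{-1}(1/e))+q^{-1}(1/e),\qquad c_u(e)=e\big(1-Q(q^{-1}(1/e))\big)-q^{-1}(1/e).$$ The set of equilibria $\mathcal X$ has cardinality: (i) $|\mathcal X|=3$ if $e>\sqrt{2\pi}$ and $c\in(c_l(e),c_u(e))$; (ii) $|\mathcal X|=2$ if $e>\sqrt{2\pi}$ and $c\in\{c_l(e),c_u(e)\}$; (iii) $|\mathcal X|=1$ otherwise.
   Context: $Q(z)=\mathbb{P}(Z>z)$ for $Z\sim\mathcal N(0,1)$; $q(z)=\frac{1}{\sqrt{2\pi}}\exp(-z^2/2)$ is the standard normal density, and $q^{-1}(p)=\sqrt{-2\log(\sqrt{2\pi}\,p)}$ for $p\in(0,1/\sqrt{2\pi}]$ is its nonnegative inverse. With nominal cost $c$ and externality parameter $e$, an adoption level $x\in[0,1]$ is an (unsubsidized) equilibrium if $Q(c-ex)=x$; $\mathcal X$ is the set of equilibria. *)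

theory Defs
  imports "HOL-Probability.Probability"
begin

text \<open>Tail function of a real random variable \<open>A\<close> on the probability space \<open>M\<close>.\<close>

definition tail :: "'a measure \<Rightarrow> ('a \<Rightarrow> real) \<Rightarrow> real \<Rightarrow> real" where
  "tail M A z = measure M {\<omega> \<in> space M. A \<omega> > z}"

text \<open>The standard normal tail is the tail of the canonical variable \<open>Z = id\<close>.  The standard
  normal density \<open>q\<close> is the library's \<open>std_normal_density\<close>.\<close>

definition normal_Q :: "real \<Rightarrow> real" where
  "normal_Q = tail std_normal_distribution (\<lambda>z. z)"

text \<open>Nonnegative inverse of the standard normal density; meaningful only for
  \<open>0 < p \<le> 1 / sqrt (2 * pi)\<close>, see the two lemmas below.\<close>

definition q_inv :: "real \<Rightarrow> real" where
  "q_inv p = sqrt (- 2 * ln (sqrt (2 * pi) * p))"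

lemma std_normal_density_q_inv:
  assumes "0 < p" "p \<le> 1 / sqrt (2 * pi)"
  shows "std_normal_density (q_inv p) = p"
proof -
  have pos: "0 < sqrt (2 * pi) * p" using assms by simp
  have "sqrt (2 * pi) * p \<le> 1" using assms by (simp add: field_simps)
  then have "ln (sqrt (2 * pi) * p) \<le> 0" using pos by simp
  then have "(q_inv p)\<^sup>2 = - 2 * ln (sqrt (2 * pi) * p)" by (simp add: q_inv_def)
  then have "exp (- (q_inv p)\<^sup>2 / 2) = sqrt (2 * pi) * p" using pos by simp
  then show ?thesis by (simp add: std_normal_density_def)
qed

lemma q_inv_nonneg:
  assumes "0 < p" "p \<le> 1 / sqrt (2 * pi)"
  shows "0 \<le> q_inv p"
proof -
  have pos: "0 < sqrt (2 * pi) * p" using assms by simp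
  have "sqrt (2 * pi) * p \<le> 1" using assms by (simp add: field_simps)
  then show ?thesis using pos by (simp add: q_inv_def)
qed

text \<open>Unsubsidized equilibria for affinity \<open>A\<close>, nominal cost \<open>c\<close> and externality parameter \<open>e\<close>.\<close>

definition equilibria :: "'a measure \<Rightarrow> ('a \<Rightarrow> real) \<Rightarrow> real \<Rightarrow> real \<Rightarrow> real set" where
  "equilibria M A c e = {x \<in> {0..1}. tail M A (c - e * x) = x}"

text \<open>The thresholds are meaningful only for \<open>e > sqrt (2 * pi)\<close>.\<close>

definition c_l :: "real \<Rightarrow> real" where
  "c_l e = e * normal_Q (q_inv (1 / e)) + q_inv (1 / e)"

definition c_u :: "real \<Rightarrow> real" where
  "c_u e = e * (1 - normal_Q (q_inv (1 / e))) - q_inv (1 / e)"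

lemma tail_std_normal:
  assumes "distributed M lborel A std_normal_density"
  shows "tail M A = normal_Q"
proof
  fix z :: real
  have A: "A \<in> borel_measurable M" and d: "distr M lborel A = std_normal_distribution"
    using assms by (auto simp: distributed_def)
  have "measure (distr M lborel A) {z<..} = measure M (A -` {z<..} \<inter> space M)"
    using A by (intro measure_distr) auto
  also have "A -` {z<..} \<inter> space M = {\<omega> \<in> space M. A \<omega> > z}" by auto
  finally show "tail M A z = normal_Q z"
    by (simp add: tail_def normal_Q_def d greaterThan_def)
qed

end

theory Submission
  imports Defs
begin

text \<open>
  The substitution \<open>u = c - e x\<close> turns the fixed point equation into \<open>u + e Q(u) = c\<close>, and \<open>Q\<close>
  maps the solutions bijectively onto the equilibria.  The left-hand side has derivative
  \<open>1 - e q(u)\<close> and stays within bounded distance of \<open>u\<close>.  For \<open>e \<le> sqrt (2 pi)\<close> it is strictly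
  increasing; for larger \<open>e\<close> it increases up to \<open>-t\<close>, decreases on \<open>[-t, t]\<close> and increases
  afterwards, where \<open>t = q_inv (1 / e)\<close>, with local maximum \<open>c_u e\<close> and local minimum \<open>c_l e\<close>.
\<close>

section \<open>The standard normal tail: symmetry, derivative and injectivity\<close>

text \<open>Passing to the gauge integral allows endpoints to be dropped as negligible sets and
  makes the fundamental theorem of calculus available.\<close>

lemma measure_std_normal:
  assumes "S \<in> sets borel"
  shows "measure std_normal_distribution S = integral S std_normal_density"
proof -
  have int: "set_integrable lborel S std_normal_density"
    unfolding set_integrable_def using assms
    by (intro integrable_mult_indicator) auto
  have "measure std_normal_distribution S = (LINT x|std_normal_distribution. indicator S x)"
    using assms by simp
  also have "\<dots> = (LINT x|lborel. std_normal_density x *\<^sub>R indicator S x)"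
    using assms by (intro integral_density) auto
  also have "\<dots> = (LINT x:S|lborel. std_normal_density x)"
    by (simp add: set_lebesgue_integral_def mult.commute)
  finally show ?thesis
    using set_borel_integral_eq_integral(2)[OF int] by simp
qed

lemma normal_Q_eq_measure: "normal_Q z = measure std_normal_distribution {z<..}"
  by (simp add: normal_Q_def tail_def greaterThan_def)

lemma normal_Q_bounds: "0 \<le> normal_Q z" "normal_Q z \<le> 1"
proof -
  interpret prob_space std_normal_distribution
    by (rule prob_space_normal_density) simp
  show "0 \<le> normal_Q z" "normal_Q z \<le> 1"
    by (simp_all add: normal_Q_eq_measure)
qed

text \<open>The negative of a standard normal variable is standard normal, and the single point
  \<open>- z\<close> has mass zero. This symmetry identifies the local maximum at \<open>-t\<close>
  with \<open>c_u e\<close>.\<close>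

lemma normal_Q_minus: "normal_Q (- z) = 1 - normal_Q z"
proof -
  interpret prob_space std_normal_distribution
    by (rule prob_space_normal_density) simp
  have "distributed std_normal_distribution lborel (\<lambda>x. x) std_normal_density"
    by (auto simp: distributed_def intro!: distr_id2)
  from normal_density_affine[OF this, of "-1" 0]
  have "tail std_normal_distribution uminus = normal_Q"
    by (intro tail_std_normal) simp
  then have "normal_Q z = measure std_normal_distribution {\<omega>. z < - \<omega>}"
    by (simp add: tail_def fun_eq_iff)
  also have "{\<omega>. z < - \<omega>} = {..<- z}"
    by auto
  finally have *: "normal_Q z = measure std_normal_distribution {..<- z}" .
  have "normal_Q (- z) = integral {- z<..} std_normal_density"
    by (simp add: normal_Q_eq_measure measure_std_normal)
  also have "\<dots> = integral {- z..} std_normal_density"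
    by (rule integral_spike_set; rule negligible_subset[of "{- z}"]) auto
  also have "\<dots> = measure std_normal_distribution {- z..}"
    by (simp add: measure_std_normal)
  also have "{- z..} = space std_normal_distribution - {..<- z}"
    by auto
  also have "measure std_normal_distribution \<dots> = 1 - normal_Q z"
    by (subst prob_compl) (simp_all add: *)
  finally show ?thesis .
qed

text \<open>Splitting the tail at a fixed \<open>b\<close> above \<open>z\<close> leaves a constant
  plus an integral over a compact interval, which is differentiated in its lower limit.\<close>

lemma normal_Q_has_field_derivative:
  "(normal_Q has_real_derivative - std_normal_density z) (at z)"
proof -
  interpret prob_space std_normal_distribution
    by (rule prob_space_normal_density) simp
  define b where "b = z + 1"
  then have "z < b" by simp
  have eq: "normal_Q x = normal_Q b + integral {x..b} std_normal_density" if "x \<le> b" for x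
  proof -
    have "{x<..} = {x<..b} \<union> {b<..}"
      using that by auto
    then have "normal_Q x = measure std_normal_distribution ({x<..b} \<union> {b<..})"
      by (simp only: normal_Q_eq_measure)
    also have "\<dots> = measure std_normal_distribution {x<..b} + normal_Q b"
      unfolding normal_Q_eq_measure by (rule finite_measure_Union) auto
    also have "measure std_normal_distribution {x<..b} = integral {x<..b} std_normal_density"
      by (simp add: measure_std_normal)
    also have "\<dots> = integral {x..b} std_normal_density"
      by (rule integral_spike_set; rule negligible_subset[of "{x}"]) auto
    finally show ?thesis by simp
  qed
  have "continuous_on {z - 1..b} std_normal_density"
    unfolding std_normal_density_def by (intro continuous_intros) auto
  then have "((\<lambda>x. integral {x..b} std_normal_density) has_real_derivative
      - std_normal_density z) (at z within {z - 1..b})"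
    by (rule integral_has_real_derivative') (simp add: b_def)
  then have "((\<lambda>x. integral {x..b} std_normal_density) has_real_derivative
      - std_normal_density z) (at z within {z - 1<..<b})"
    by (rule DERIV_subset) auto
  then have "((\<lambda>x. integral {x..b} std_normal_density) has_real_derivative
      - std_normal_density z) (at z)"
    by (subst (asm) at_within_open) (auto simp: b_def)
  then have "((\<lambda>x. normal_Q b + integral {x..b} std_normal_density) has_real_derivative
      - std_normal_density z) (at z)"
    by (auto intro!: derivative_eq_intros)
  then show ?thesis
    \<comment> \<open>The splitting \<open>eq\<close> holds only for \<open>x \<le> b\<close>; the
      open set \<open>{..<b}\<close> is a neighbourhood of \<open>z\<close> on which it
      applies.\<close>
    by (rule has_field_derivative_transform_within_open[of _ _ _ "{..<b}"])
      (auto simp: \<open>z < b\<close> simp flip: eq)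
qed

lemma inj_normal_Q: "inj normal_Q"
proof (rule linorder_injI)
  fix x y :: real
  assume "x < y"
  then have "normal_Q y < normal_Q x"
    by (rule DERIV_neg_imp_decreasing)
      (rule exI, rule conjI, rule normal_Q_has_field_derivative, simp add: normal_density_pos)
  then show "normal_Q x \<noteq> normal_Q y" by simp
qed

section \<open>Equilibria as solutions of \<open>u + e * normal_Q u = c\<close>\<close>

text \<open>An equilibrium \<open>x\<close> comes from \<open>u = c - e * x\<close>. Conversely, a
  value of \<open>normal_Q\<close> is a probability, so it lies in the unit interval.\<close>

lemma equilibria_eq_image:
  assumes "distributed M lborel A std_normal_density"
  shows "equilibria M A c e = normal_Q ` {u. u + e * normal_Q u = c}"
  unfolding equilibria_def tail_std_normal[OF assms]
proof (intro set_eqI iffI)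
  fix x
  assume "x \<in> {x \<in> {0..1}. normal_Q (c - e * x) = x}"
  then show "x \<in> normal_Q ` {u. u + e * normal_Q u = c}"
    by (intro image_eqI[of _ _ "c - e * x"]) auto
next
  fix x
  assume "x \<in> normal_Q ` {u. u + e * normal_Q u = c}"
  then obtain u where "u + e * normal_Q u = c" "x = normal_Q u"
    by auto
  moreover from this have "c - e * normal_Q u = u" by simp
  ultimately show "x \<in> {x \<in> {0..1}. normal_Q (c - e * x) = x}"
    using normal_Q_bounds[of u] by simp
qed

lemma card_equilibria:
  assumes "distributed M lborel A std_normal_density"
  shows "card (equilibria M A c e) = card {u. u + e * normal_Q u = c}"
  unfolding equilibria_eq_image[OF assms]
  by (intro card_image inj_on_subset[OF inj_normal_Q]) simp

section \<open>Counting the points where a function takes a given value\<close>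

lemma ex1_solution_strict_mono:
  fixes g :: "real \<Rightarrow> real"
  assumes cont: "continuous_on UNIV g" and mono: "strict_mono g"
    and bounds: "\<And>u. u \<le> g u" "\<And>u. g u \<le> u + d"
  shows "\<exists>!u. g u = c"
proof (rule ex_ex1I)
  \<comment> \<open>The bounds at \<open>0\<close> give \<open>0 \<le> g 0 \<le> d\<close>, hence
    \<open>c - d \<le> c\<close>.\<close>
  have "g (c - d) \<le> c" "c \<le> g c" "c - d \<le> c"
    using bounds[of "c - d"] bounds[of c] bounds(1)[of 0] bounds(2)[of 0] by auto
  then show "\<exists>u. g u = c"
    using IVT'[of g "c - d" c c] cont continuous_on_subset by blast
qed (use strict_mono_eq[OF mono] in auto)

text \<open>On each of the three pieces \<open>g\<close> is injective. The value \<open>c\<close> is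
  taken on the left piece iff \<open>c \<le> g a\<close>, on the middle one iff
  \<open>g b \<le> c \<le> g a\<close>, and on the right one iff \<open>g b \<le> c\<close>. Two of
  these solutions coincide exactly when they meet at a turning point, that is, for
  \<open>c = g a\<close> or \<open>c = g b\<close>.\<close>

lemma card_solutions_up_down_up:
  fixes g :: "real \<Rightarrow> real"
  assumes cont: "continuous_on UNIV g" and "a < b"
    and incr1: "strict_mono_on {..a} g"
    and decr: "\<And>x y. a \<le> x \<Longrightarrow> x < y \<Longrightarrow> y \<le> b \<Longrightarrow> g y < g x"
    and incr2: "strict_mono_on {b..} g"
    and bounds: "\<And>u. u \<le> g u" "\<And>u. g u \<le> u + d"
  shows "card {u. g u = c} =
    (if g b < c \<and> c < g a then 3 else if c = g a \<or> c = g b then 2 else 1)"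
proof -
  have c': "continuous_on S g" for S
    using cont continuous_on_subset by blast
  have "g b < g a"
    using decr[of a b] \<open>a < b\<close> by simp
  have L: "\<exists>u. u \<le> a \<and> g u = c" if "c \<le> g a"
  proof -
    \<comment> \<open>A point of the left piece so far down that the upper bound
      \<open>u + d\<close> is at most \<open>c\<close>.\<close>
    have "g (min a (c - d)) \<le> c"
      using bounds(2)[of "min a (c - d)"] by linarith
    then show ?thesis
      using IVT'[of g "min a (c - d)" c a, OF _ that _ c'] by auto
  qed
  have M: "\<exists>u. a \<le> u \<and> u \<le> b \<and> g u = c" if "g b \<le> c" "c \<le> g a"
    using IVT2'[of g b c a, OF that _ c'] \<open>a < b\<close> by auto
  have R: "\<exists>u. b \<le> u \<and> g u = c" if "g b \<le> c"
  proof -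
    have "c \<le> g (max b c)"
      using bounds(1)[of "max b c"] by linarith
    then show ?thesis
      using IVT'[of g b c "max b c", OF that _ _ c'] by auto
  qed
  have Lu: "u = v" if "u \<le> a" "v \<le> a" "g u = g v" for u v
    using strict_mono_on_eqD[OF incr1, of u v] that by auto
  have Mu: "u = v" if "a \<le> u" "u \<le> b" "a \<le> v" "v \<le> b" "g u = g v" for u v
    using decr[of u v] decr[of v u] that by linarith
  have Ru: "u = v" if "b \<le> u" "b \<le> v" "g u = g v" for u v
    using strict_mono_on_eqD[OF incr2, of u v] that by auto
  have Lb: "g u \<le> g a" if "u \<le> a" for u
    using strict_mono_on_leD[OF incr1, of u a] that by auto
  have Mb: "g b \<le> g u" "g u \<le> g a" if "a \<le> u" "u \<le> b" for u
    using decr[of a u] decr[of u b] that by (cases "u = a"; cases "u = b"; force)+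
  have Rb: "g b \<le> g u" if "b \<le> u" for u
    using strict_mono_on_leD[OF incr2, of b u] that by auto
  consider "c < g b" | "c = g b" | "g b < c" "c < g a" | "c = g a" | "g a < c"
    by linarith
  then show ?thesis
  proof cases
    case 1
    obtain u where "u \<le> a" "g u = c"
      using L 1 \<open>g b < g a\<close> by auto
    have "g v = c \<longleftrightarrow> v = u" for v
      using 1 Mb(1)[of v] Rb[of v] Lu[of v u] \<open>u \<le> a\<close> \<open>g u = c\<close> by smt
    then have "{u. g u = c} = {u}" by auto
    then show ?thesis using 1 \<open>g b < g a\<close> by simp
  next
    case 2
    obtain u where u: "u \<le> a" "g u = c"
      using L 2 \<open>g b < g a\<close> by auto
    \<comment> \<open>The middle and right pieces share the solution \<open>b\<close>, where
      \<open>g\<close> has its local minimum.\<close>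
    have "g v = c \<longleftrightarrow> v = u \<or> v = b" for v
      using 2 Mu[of v b] Ru[of v b] Lu[of v u] u \<open>a < b\<close> by smt
    then have "{u. g u = c} = {u, b}" by auto
    then show ?thesis using 2 \<open>g b < g a\<close> u \<open>a < b\<close> by simp
  next
    case 3
    obtain u where u: "u \<le> a" "g u = c"
      using L 3 by auto
    obtain v where v: "a \<le> v" "v \<le> b" "g v = c"
      using M 3 by auto
    obtain w where w: "b \<le> w" "g w = c"
      using R 3 by auto
    \<comment> \<open>Since \<open>c\<close> lies strictly between \<open>g b\<close> and
      \<open>g a\<close>, no solution is a turning point, so the three solutions are
      distinct.\<close>
    have ne: "u \<noteq> a" "v \<noteq> a" "v \<noteq> b" "w \<noteq> b"
      using u v w 3 by auto
    have "g x = c \<longleftrightarrow> x = u \<or> x = v \<or> x = w" for x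
      using Lu[of x u] Mu[of x v] Ru[of x w] u v w by smt
    then have "{u. g u = c} = {u, v, w}" by auto
    moreover have "u < v" "v < w"
      using u v w ne by linarith+
    ultimately show ?thesis using 3 by simp
  next
    case 4
    obtain w where w: "b \<le> w" "g w = c"
      using R 4 \<open>g b < g a\<close> by auto
    \<comment> \<open>The left and middle pieces share the solution \<open>a\<close>, where
      \<open>g\<close> has its local maximum.\<close>
    have "g v = c \<longleftrightarrow> v = a \<or> v = w" for v
      using 4 Mu[of v a] Lu[of v a] Ru[of v w] w \<open>a < b\<close> by smt
    then have "{u. g u = c} = {a, w}" by auto
    then show ?thesis using 4 \<open>g b < g a\<close> w \<open>a < b\<close> by simp
  next
    case 5
    obtain w where w: "b \<le> w" "g w = c"
      using R 5 \<open>g b < g a\<close> by auto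
    have "g v = c \<longleftrightarrow> v = w" for v
      using 5 Mb(2)[of v] Lb[of v] Ru[of v w] w by smt
    then have "{u. g u = c} = {w}" by auto
    then show ?thesis using 5 \<open>g b < g a\<close> by simp
  qed
qed

section \<open>The sign of \<open>1 - e * std_normal_density u\<close> and the two regimes of
  \<open>e\<close>\<close>

lemma std_normal_density_less_iff:
  "std_normal_density x < std_normal_density y \<longleftrightarrow> \<bar>y\<bar> < \<bar>x\<bar>"
proof -
  have "\<not> \<bar>x\<bar> \<le> \<bar>y\<bar> \<longleftrightarrow> \<not> x\<^sup>2 \<le> y\<^sup>2"
    by (simp only: abs_le_square_iff)
  then show ?thesis
    by (simp add: std_normal_density_def divide_less_cancel not_le)
qed

text \<open>The logarithm is strictly negative here. Positivity of \<open>t = q_inv (1 / e)\<close>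
  makes the decreasing piece between \<open>-t\<close> and \<open>t\<close> nondegenerate.\<close>

lemma q_inv_pos:
  assumes "0 < p" "p < 1 / sqrt (2 * pi)"
  shows "0 < q_inv p"
proof -
  have "0 < sqrt (2 * pi) * p" "sqrt (2 * pi) * p < 1"
    using assms by (simp_all add: field_simps)
  then show ?thesis by (simp add: q_inv_def)
qed

theorem proposition5p5:
  fixes M :: "'a measure" and A :: "'a \<Rightarrow> real" and c e :: real
  assumes "prob_space M"
    and "distributed M lborel A std_normal_density"
    and "c \<ge> 0" and "e \<ge> 0"
  shows "(e > sqrt (2 * pi) \<and> c \<in> {c_l e<..<c_u e} \<longrightarrow> card (equilibria M A c e) = 3)
    \<and> (e > sqrt (2 * pi) \<and> c \<in> {c_l e, c_u e} \<longrightarrow> card (equilibria M A c e) = 2)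
    \<and> (\<not> (e > sqrt (2 * pi) \<and> c \<in> {c_l e<..<c_u e})
       \<and> \<not> (e > sqrt (2 * pi) \<and> c \<in> {c_l e, c_u e})
       \<longrightarrow> card (equilibria M A c e) = 1)"
proof -
  define g where "g = (\<lambda>u. u + e * normal_Q u)"
  have card: "card (equilibria M A c e) = card {u. g u = c}"
    unfolding g_def by (rule card_equilibria[OF assms(2)])
  have deriv: "(g has_real_derivative 1 - e * std_normal_density u) (at u)" for u
    unfolding g_def
    by (auto intro!: derivative_eq_intros normal_Q_has_field_derivative)
  have cont: "continuous_on S g" for S
    using deriv by (meson DERIV_isCont continuous_at_imp_continuous_on)
  have bounds: "u \<le> g u" "g u \<le> u + e" for u
    using \<open>e \<ge> 0\<close> normal_Q_bounds[of u]
    by (auto simp: g_def mult_left_le)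
  \<comment> \<open>The sign of the derivative is required only strictly between \<open>x\<close>
    and \<open>y\<close>, because it vanishes at the turning points \<open>-t\<close> and
    \<open>t\<close>, and at \<open>0\<close> when \<open>e = sqrt (2 * pi)\<close>.\<close>
  have incr: "g x < g y" if "x < y" "\<And>u. x < u \<Longrightarrow> u < y \<Longrightarrow> e * std_normal_density u < 1" for x y
    using that(1)
    by (rule DERIV_pos_imp_increasing_open[OF _ _ cont]) (use deriv that(2) in force)
  have decr: "g y < g x" if "x < y" "\<And>u. x < u \<Longrightarrow> u < y \<Longrightarrow> 1 < e * std_normal_density u" for x y
    using that(1)
    by (rule DERIV_neg_imp_decreasing_open[OF _ _ cont]) (use deriv that(2) in force)
  show ?thesis
  proof (cases "e > sqrt (2 * pi)")
    case True
    have "0 < sqrt (2 * pi)" by simp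
    then have "0 < e" using True by linarith
    have p: "0 < 1 / e" "1 / e < 1 / sqrt (2 * pi)"
      using True \<open>0 < e\<close> by (auto intro: divide_strict_left_mono)
    define t where "t = q_inv (1 / e)"
    have "0 < t"
      unfolding t_def by (rule q_inv_pos[OF p])
    have "std_normal_density t = 1 / e"
      unfolding t_def using p by (intro std_normal_density_q_inv) auto
    then have et: "e * std_normal_density t = 1"
      using \<open>0 < e\<close> by simp
    \<comment> \<open>As \<open>e * std_normal_density t = 1\<close>, comparing with
      \<open>1\<close> amounts to comparing the densities at \<open>u\<close> and \<open>t\<close>,
      hence their absolute values.\<close>
    have lt: "e * std_normal_density u < 1 \<longleftrightarrow> \<bar>t\<bar> < \<bar>u\<bar>"
      and gt: "1 < e * std_normal_density u \<longleftrightarrow> \<bar>u\<bar> < \<bar>t\<bar>" for u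
      using mult_less_cancel_left_pos[OF \<open>0 < e\<close>, of "std_normal_density u" "std_normal_density t"]
        mult_less_cancel_left_pos[OF \<open>0 < e\<close>, of "std_normal_density t" "std_normal_density u"]
      by (simp_all only: et std_normal_density_less_iff)
    have "card {u. g u = c} =
      (if g t < c \<and> c < g (- t) then 3 else if c = g (- t) \<or> c = g t then 2 else 1)"
    proof (rule card_solutions_up_down_up[OF cont _ _ _ _ bounds])
      show "- t < t" using \<open>0 < t\<close> by simp
      show "strict_mono_on {..- t} g" "strict_mono_on {t..} g"
        using \<open>0 < t\<close> by (auto intro!: strict_mono_onI incr simp: lt)
      show "g y < g x" if "- t \<le> x" "x < y" "y \<le> t" for x y
        using that by (intro decr) (auto simp: gt)
    qed
    \<comment> \<open>The second equation uses the symmetry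
      \<open>normal_Q (- t) = 1 - normal_Q t\<close>.\<close>
    moreover have "g t = c_l e" "g (- t) = c_u e"
      by (simp_all add: g_def c_l_def c_u_def normal_Q_minus flip: t_def)
    ultimately show ?thesis
      using card True by auto
  next
    case False
    \<comment> \<open>The density has its strict maximum \<open>1 / sqrt (2 * pi)\<close> at
      \<open>0\<close>, so equality with \<open>1\<close> can occur only there. For
      \<open>e = 0\<close> the product is simply \<open>0\<close>.\<close>
    have lt: "e * std_normal_density u < 1" if "u \<noteq> 0" for u
    proof -
      have "e * std_normal_density 0 \<le> 1"
        using False by (simp add: std_normal_density_def)
      moreover have "std_normal_density u < std_normal_density 0"
        using that by (simp only: std_normal_density_less_iff)
      then have "e * std_normal_density u < e * std_normal_density 0" if "e \<noteq> 0"
        using that \<open>e \<ge> 0\<close> by (intro mult_strict_left_mono) auto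
      ultimately show ?thesis by fastforce
    qed
    have "strict_mono g"
    proof (rule strict_monoI)
      fix x y :: real
      assume "x < y"
      show "g x < g y"
      \<comment> \<open>The derivative may vanish at \<open>0\<close>, so an interval with
        \<open>0\<close> in its interior is cut there.\<close>
      proof (cases "x < 0 \<and> 0 < y")
        case True
        then have "g x < g 0" "g 0 < g y"
          by (auto intro!: incr lt)
        then show ?thesis by simp
      next
        case False
        then show ?thesis
          using \<open>x < y\<close> by (intro incr lt) auto
      qed
    qed
    then have "\<exists>!u. g u = c"
      by (rule ex1_solution_strict_mono[OF cont _ bounds])
    then obtain v where "g u = c \<longleftrightarrow> u = v" for u
      by metis
    then have "card {u. g u = c} = 1"
      by simp
    then show ?thesis
      using card False by simp
  qed
qed

end
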